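(* Let $N=4$ (so that $2^*=4$), $\mu_1,\mu_2>0$ and $0<\beta<\mu_1$. Then the system $$-\Delta u=\mu_1u^{3}+\beta uv^{2},\qquad -\Delta v=\mu_2v^{3}+\beta vu^{2}\qquad\text{in }B_2\setminus\{0\},\qquad u,v>0,\quad u,v\in C^2(B_2\setminus\{0\}),$$ has a radially symmetric solution $(u,v)$ with $D(u,v)<0$ such that $$\lim_{x\to0}|x|u(x)=\frac1{\sqrt{\mu_1}}\qquad\text{and}\qquad\lim_{x\to0}|x|v(x)=0;$$ in other words, for this solution there is no constant $C_1>0$ such that $v(x)\ge C_1|x|^{-1}$ for $|x|>0$ small.
   Context: $B_r:=\{x\in\mathbb R^4:|x|<r\}$. For $0<r<2$ put $$D(r;u,v):=\int_{\partial B_r}\Big[\Big(u\tfrac{\partial u}{\partial\nu}+v\tfrac{\partial v}{\partial\nu}\Big)-\tfrac r2(|\nabla u|^2+|\nabla v|^2)+r\Big|\tfrac{\partial u}{\partial\nu}\Big|^2+r\Big|\tfrac{\partial v}{\partial\nu}\Big|^2+\tfrac r{4}\big(\mu_1u^{4}+\mu_2v^{4}+2\beta u^{2}v^{2}\big)\Big]d\sigma,$$ with $\nu$ the unit outer normal of $\partial B_r$. By the Pohozaev identity $D(r;u,v)$ does not depend on $r$ for a solution $(u,v)$; its constant value is denoted $D(u,v)$. *)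

theory Defs
  imports "HOL-Analysis.Analysis"
begin

definition pderiv_dir :: "'a::euclidean_space \<Rightarrow> ('a \<Rightarrow> real) \<Rightarrow> 'a \<Rightarrow> real" where
  "pderiv_dir b f x = frechet_derivative f (at x) b"

definition grad :: "('a::euclidean_space \<Rightarrow> real) \<Rightarrow> 'a \<Rightarrow> 'a" where
  "grad f x = (\<Sum>b\<in>Basis. pderiv_dir b f x *\<^sub>R b)"

definition laplacian :: "('a::euclidean_space \<Rightarrow> real) \<Rightarrow> 'a \<Rightarrow> real" where
  "laplacian f x = (\<Sum>b\<in>Basis. pderiv_dir b (pderiv_dir b f) x)"

(* C1_on and C2_on are meant for open S: derivatives are taken in the full space. *)

definition C1_on :: "'a::euclidean_space set \<Rightarrow> ('a \<Rightarrow> real) \<Rightarrow> bool" where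
  "C1_on S f \<longleftrightarrow> (\<forall>x\<in>S. f differentiable (at x)) \<and>
     (\<forall>b\<in>Basis. continuous_on S (pderiv_dir b f))"

definition C2_on :: "'a::euclidean_space set \<Rightarrow> ('a \<Rightarrow> real) \<Rightarrow> bool" where
  "C2_on S f \<longleftrightarrow> C1_on S f \<and> (\<forall>b\<in>Basis. C1_on S (pderiv_dir b f))"

(* Surface measure on the sphere of radius r > 0 in dimension n, in its polar-coordinate form:
   sigma(A) is n / r times the Lebesgue measure of the open cone segment over A, that is of the
   points x with 0 < |x| < r and r x / |x| in A.  The underlying space is the sphere itself,
   so that only the values of an integrand on the sphere matter. *)

definition sphere_measure :: "real \<Rightarrow> 'a::euclidean_space measure" where
  "sphere_measure r = scale_measure (ennreal (real DIM('a) / r))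
     (distr (restrict_space lborel (ball 0 r - {0})) (restrict_space borel (sphere 0 r))
        (\<lambda>x. (r / norm x) *\<^sub>R x))"

lemma emeasure_sphere_measure:
  fixes A :: "'a::euclidean_space set"
  assumes "0 < r" "A \<in> sets borel" "A \<subseteq> sphere 0 r"
  shows "emeasure (sphere_measure r) A =
    ennreal (real DIM('a) / r) * emeasure lborel {x \<in> ball 0 r - {0}. (r / norm x) *\<^sub>R x \<in> A}"
proof -
  let ?f = "\<lambda>x::'a. (r / norm x) *\<^sub>R x"
  let ?R = "restrict_space lborel (ball 0 r - {0::'a})"
  have "?f \<in> borel_measurable ?R"
    by (rule measurable_restrict_space1) simp
  then have m: "?f \<in> measurable ?R (restrict_space borel (sphere 0 r))"
    using assms(1) by (intro measurable_restrict_space2) (auto simp: space_restrict_space)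
  have A: "A \<in> sets (restrict_space borel (sphere 0 r))"
    using assms(2,3) by (auto simp: sets_restrict_space_iff)
  have "emeasure (distr ?R (restrict_space borel (sphere 0 r)) ?f) A = emeasure ?R (?f -` A \<inter> space ?R)"
    by (rule emeasure_distr[OF m A])
  also have "?f -` A \<inter> space ?R = {x \<in> ball 0 r - {0}. ?f x \<in> A}"
    by (auto simp: space_restrict_space)
  also have "emeasure ?R \<dots> = emeasure lborel {x \<in> ball 0 r - {0}. ?f x \<in> A}"
    by (rule emeasure_restrict_space) auto
  finally show ?thesis
    by (simp add: sphere_measure_def)
qed

definition normal_deriv :: "('a::euclidean_space \<Rightarrow> real) \<Rightarrow> 'a \<Rightarrow> real" where
  "normal_deriv f x = grad f x \<bullet> (x /\<^sub>R norm x)"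

definition pohozaev :: "real \<Rightarrow> real \<Rightarrow> real \<Rightarrow> real \<Rightarrow> (real^4 \<Rightarrow> real) \<Rightarrow> (real^4 \<Rightarrow> real) \<Rightarrow> real" where
  "pohozaev \<mu>1 \<mu>2 \<beta> r u v = (LINT x|sphere_measure r.
     (u x * normal_deriv u x + v x * normal_deriv v x)
     - r / 2 * ((norm (grad u x))\<^sup>2 + (norm (grad v x))\<^sup>2)
     + r * \<bar>normal_deriv u x\<bar>\<^sup>2 + r * \<bar>normal_deriv v x\<bar>\<^sup>2
     + r / 4 * (\<mu>1 * u x ^ 4 + \<mu>2 * v x ^ 4 + 2 * \<beta> * (u x)\<^sup>2 * (v x)\<^sup>2))"

definition is_positive_solution ::
  "real \<Rightarrow> real \<Rightarrow> real \<Rightarrow> (real^4 \<Rightarrow> real) \<Rightarrow> (real^4 \<Rightarrow> real) \<Rightarrow> bool" where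
  "is_positive_solution \<mu>1 \<mu>2 \<beta> u v \<longleftrightarrow>
     C2_on (ball 0 2 - {0}) u \<and> C2_on (ball 0 2 - {0}) v \<and>
     (\<forall>x\<in>ball 0 2 - {0}. 0 < u x \<and> 0 < v x \<and>
        - laplacian u x = \<mu>1 * u x ^ 3 + \<beta> * u x * (v x)\<^sup>2 \<and>
        - laplacian v x = \<mu>2 * v x ^ 3 + \<beta> * v x * (u x)\<^sup>2)"

definition radially_symmetric_on :: "'a::real_normed_vector set \<Rightarrow> ('a \<Rightarrow> real) \<Rightarrow> bool" where
  "radially_symmetric_on S f \<longleftrightarrow> (\<forall>x\<in>S. \<forall>y\<in>S. norm x = norm y \<longrightarrow> f x = f y)"

end

theory Submission
  imports Defs
begin

text \<open>
  Write \<open>u(x) = U / |x|\<close> and \<open>v(x) = V / |x|\<close> with \<open>U\<close>, \<open>V\<close> functions of \<open>\<tau> = - ln |x|\<close>. In dimension 4 this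
  Emden-Fowler substitution turns the system into the autonomous one
  \<open>U'' = U - \<mu>1 U^3 - \<beta> U V^2\<close>, \<open>V'' = V - \<mu>2 V^3 - \<beta> V U^2\<close>. The point \<open>(U, V) = (1 / sqrt \<mu>1, 0)\<close>
  is an equilibrium; linearised there, the \<open>V\<close> equation reads \<open>V'' = \<kappa>^2 V\<close> with
  \<open>\<kappa>^2 = 1 - \<beta> / \<mu>1 > 0\<close>, so there is a solution tending to the equilibrium
  with \<open>V\<close> positive and comparable to \<open>exp (- \<kappa> \<tau>)\<close>. This solution is the one required: \<open>|x| u\<close> tends to
  \<open>1 / sqrt \<mu>1\<close> and \<open>|x| v\<close> tends to 0.

  It is constructed as a convergent power series in \<open>s = c |x|^\<kappa>\<close>. With
  \<open>U = (1 + W) / sqrt \<mu>1\<close> and \<open>\<theta> = s d/ds\<close>, the operator \<open>d/d\<tau>\<close> becomes \<open>- \<kappa> \<theta>\<close>, and the coefficient of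
  \<open>s^n\<close> in the equations determines \<open>W_n\<close> and \<open>V_n\<close> from the earlier ones: the linear
  parts multiply them by \<open>\<kappa>^2 n^2 + 2\<close> and \<open>\<kappa>^2 (n^2 - 1)\<close>, while the remaining terms are at
  least quadratic. The only resonance is \<open>n = 1\<close> in the second equation, where \<open>V_1 = 1\<close> is prescribed
  (lemma \<open>fps_pair_recursion\<close>). Since the nonlinearity is quadratically small, the partial sums of
  \<open>\<Sum> |W_n| r^n\<close> and \<open>\<Sum> |V_n| r^n\<close> stay below a fixed small number for small \<open>r\<close> (lemma
  \<open>psum_recursion_bound\<close>), which gives a positive radius of convergence. The constant \<open>c\<close>
  is free (scale invariance of the system) and is chosen so small that the ball of radius 2
  lies in the region where the series converge and \<open>U\<close>, \<open>V\<close> are positive.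

  In these variables the Pohozaev integrand on the sphere of radius \<open>r\<close> equals \<open>H / r^3\<close>, where
  \<open>H = (U'^2 + V'^2) / 2 - (U^2 + V^2) / 2 + (\<mu>1 U^4 + \<mu>2 V^4 + 2 \<beta> U^2 V^2) / 4\<close> is the conserved
  energy. Its value at the equilibrium is \<open>- 1 / (4 \<mu>1) < 0\<close>, and the sphere has measure
  proportional to \<open>r^3\<close>, so the integral is a negative constant (lemma \<open>energy\<close>).
\<close>

section \<open>Radial functions\<close>

lemma pderiv_dir_eq:
  assumes "(f has_derivative f') (at x)"
  shows "pderiv_dir b f x = f' b"
  using frechet_derivative_at[OF assms] by (simp add: pderiv_dir_def)

lemma has_derivative_radial:
  fixes x :: "'a::euclidean_space"
  assumes "x \<noteq> 0" "(f has_real_derivative f') (at (norm x))"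
  shows "((\<lambda>x. f (norm x)) has_derivative (\<lambda>h. f' * (x \<bullet> h / norm x))) (at x)"
proof -
  have "(norm has_derivative (\<lambda>h. x \<bullet> h / norm x)) (at x)"
    using has_derivative_norm[OF assms(1)]
    by (simp add: sgn_div_norm inner_commute divide_inverse mult.commute)
  from has_derivative_compose[OF this assms(2)[unfolded has_field_derivative_def]]
  show ?thesis .
qed

lemma grad_radial:
  fixes x :: "'a::euclidean_space"
  assumes "x \<noteq> 0" "(f has_real_derivative f') (at (norm x))"
  shows "grad (\<lambda>x. f (norm x)) x = (f' / norm x) *\<^sub>R x"
proof -
  have "grad (\<lambda>x. f (norm x)) x = (\<Sum>b\<in>Basis. (f' / norm x) *\<^sub>R ((x \<bullet> b) *\<^sub>R b))"
    unfolding grad_def by (simp add: pderiv_dir_eq[OF has_derivative_radial[OF assms]])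
  also have "\<dots> = (f' / norm x) *\<^sub>R x"
    by (simp only: scaleR_sum_right[symmetric] euclidean_representation)
  finally show ?thesis .
qed

lemma norm_grad_radial:
  fixes x :: "'a::euclidean_space"
  assumes "x \<noteq> 0" "(f has_real_derivative f') (at (norm x))"
  shows "norm (grad (\<lambda>x. f (norm x)) x) = \<bar>f'\<bar>"
  using assms by (simp add: grad_radial)

lemma normal_deriv_radial:
  fixes x :: "'a::euclidean_space"
  assumes "x \<noteq> 0" "(f has_real_derivative f') (at (norm x))"
  shows "normal_deriv (\<lambda>x. f (norm x)) x = f'"
  using assms by (simp add: normal_deriv_def grad_radial dot_square_norm power2_eq_square)

lemma radial_C2_laplacian:
  fixes f f1 f2 :: "real \<Rightarrow> real" and R :: real
  defines "B \<equiv> ball 0 R - {0::'a::euclidean_space}"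
  assumes f: "\<And>t. 0 < t \<Longrightarrow> t < R \<Longrightarrow> (f has_real_derivative f1 t) (at t)"
    and f1: "\<And>t. 0 < t \<Longrightarrow> t < R \<Longrightarrow> (f1 has_real_derivative f2 t) (at t)"
    and f2: "continuous_on {0<..<R} f2"
  shows "C2_on B (\<lambda>x::'a. f (norm x))"
    and "\<And>x::'a. x \<in> B \<Longrightarrow>
      laplacian (\<lambda>x. f (norm x)) x = f2 (norm x) + (real DIM('a) - 1) * f1 (norm x) / norm x"
proof -
  have oB: "open B" by (auto simp: B_def)
  \<comment> \<open>The partial derivative in direction \<open>b\<close> and its differential.\<close>
  define g where "g b x = f1 (norm x) * (x \<bullet> b / norm x)" for b x :: 'a
  define g' where "g' b x h = f2 (norm x) * (x \<bullet> h / norm x) * (x \<bullet> b / norm x)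
     + f1 (norm x) * (h \<bullet> b / norm x - (x \<bullet> b) * (x \<bullet> h) / norm x ^ 3)" for b x h :: 'a
  have D1: "((\<lambda>x. f (norm x)) has_derivative (\<lambda>h. f1 (norm x) * (x \<bullet> h / norm x))) (at x)"
    if "x \<in> B" for x
    using that by (intro has_derivative_radial f) (auto simp: B_def)
  have P1: "pderiv_dir b (\<lambda>x. f (norm x)) x = g b x" if "x \<in> B" for b x
    using pderiv_dir_eq[OF D1[OF that]] by (simp add: g_def)
  have D2: "(g b has_derivative g' b x) (at x)" if "x \<in> B" for b x
  proof -
    have x: "x \<noteq> 0" "0 < norm x" "norm x < R" using that by (auto simp: B_def)
    have n: "(norm has_derivative (\<lambda>h. x \<bullet> h / norm x)) (at x)"
      using has_derivative_norm[OF x(1)]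
      by (simp add: sgn_div_norm inner_commute divide_inverse mult.commute)
    show ?thesis
      unfolding g_def[abs_def] g'_def[abs_def]
      apply (rule has_derivative_eq_rhs)
       apply (rule has_derivative_mult[OF has_derivative_radial[OF x(1) f1[OF x(2,3)]]])
       apply (rule has_derivative_divide'[OF _ n])
        apply (rule derivative_intros)+
      using x by (auto simp: fun_eq_iff field_simps power3_eq_cube)
  qed
  have D2': "(pderiv_dir b (\<lambda>x. f (norm x)) has_derivative g' b x) (at x)" if "x \<in> B" for b x
    by (rule has_derivative_transform_within_open[OF D2[OF that] oB that]) (simp add: P1)
  have P2: "pderiv_dir c (pderiv_dir b (\<lambda>x. f (norm x))) x = g' b x c" if "x \<in> B" for b c x
    by (rule pderiv_dir_eq[OF D2'[OF that]])
  have c1: "continuous_on {0<..<R} f1"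
    by (rule DERIV_continuous_on) (auto intro: has_field_derivative_at_within f1)
  have n: "continuous_on B (\<lambda>x. h (norm x))" if "continuous_on {0<..<R} h" for h :: "real \<Rightarrow> real"
    by (rule continuous_on_compose2[OF that]) (auto simp: B_def intro!: continuous_intros)
  have "continuous_on B (g b)" for b
    unfolding g_def[abs_def] by (intro continuous_intros n c1) (auto simp: B_def)
  then have cg: "continuous_on B (pderiv_dir b (\<lambda>x. f (norm x)))" for b
    by (subst continuous_on_cong[OF refl P1])
  have "continuous_on B (\<lambda>x. g' b x c)" for b c
    unfolding g'_def[abs_def] by (intro continuous_intros n c1 f2) (auto simp: B_def)
  then have cg': "continuous_on B (pderiv_dir c (pderiv_dir b (\<lambda>x. f (norm x))))" for b c
    by (subst continuous_on_cong[OF refl P2])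
  show "C2_on B (\<lambda>x. f (norm x))"
    unfolding C2_on_def C1_on_def using D1 D2' cg cg' by (auto simp: differentiable_def)
  fix x assume x: "x \<in> B"
  then have nz: "norm x \<noteq> 0" by (auto simp: B_def)
  have s1: "(\<Sum>b\<in>Basis. (x \<bullet> b) * (x \<bullet> b)) = (norm x)\<^sup>2"
    by (simp add: euclidean_inner[of x x, symmetric] dot_square_norm)
  have "laplacian (\<lambda>x. f (norm x)) x = (\<Sum>b\<in>Basis. g' b x b)"
    by (simp add: laplacian_def P2[OF x])
  also have "\<dots> = (\<Sum>b\<in>Basis. f2 (norm x) / norm x ^ 2 * ((x \<bullet> b) * (x \<bullet> b)) + f1 (norm x) / norm x
      - f1 (norm x) / norm x ^ 3 * ((x \<bullet> b) * (x \<bullet> b)))"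
    using nz by (intro sum.cong) (auto simp: g'_def field_simps power2_eq_square power3_eq_cube)
  also have "\<dots> = f2 (norm x) / norm x ^ 2 * (norm x)\<^sup>2 + real DIM('a) * (f1 (norm x) / norm x)
      - f1 (norm x) / norm x ^ 3 * (norm x)\<^sup>2"
    by (simp only: sum.distrib sum_subtractf sum_distrib_left[symmetric] s1 sum_constant)
  also have "\<dots> = f2 (norm x) + (real DIM('a) - 1) * f1 (norm x) / norm x"
    using nz by (simp add: field_simps power2_eq_square power3_eq_cube)
  finally show "laplacian (\<lambda>x. f (norm x)) x = f2 (norm x) + (real DIM('a) - 1) * f1 (norm x) / norm x" .
qed

section \<open>Integrals of constants over spheres\<close>

lemma measure_sphere_measure:
  assumes "0 < r"
  shows "measure (sphere_measure r :: 'a::euclidean_space measure) (sphere 0 r)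
     = real DIM('a) * unit_ball_vol (real DIM('a)) * r ^ (DIM('a) - 1)"
proof -
  have "(r / norm x) *\<^sub>R x \<in> sphere 0 r" if "x \<noteq> 0" for x :: 'a
    using that assms by simp
  then have "{x \<in> ball 0 r - {0::'a}. (r / norm x) *\<^sub>R x \<in> sphere 0 r} = ball 0 r - {0}" by blast
  then have "emeasure (sphere_measure r) (sphere (0::'a) r)
     = ennreal (real DIM('a) / r) * emeasure lborel (ball (0::'a) r - {0})"
    using emeasure_sphere_measure[OF assms, of "sphere (0::'a) r"] by simp
  also have "emeasure lborel (ball (0::'a) r - {0}) = emeasure lborel (ball (0::'a) r)"
    by (rule emeasure_Diff_null_set) (auto intro: null_setsI)
  also have "\<dots> = ennreal (unit_ball_vol (real DIM('a)) * r ^ DIM('a))"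
    using assms by (simp add: emeasure_ball)
  also have "ennreal (real DIM('a) / r) * \<dots> = ennreal (real DIM('a) / r * (unit_ball_vol (real DIM('a)) * r ^ DIM('a)))"
    using assms by (intro ennreal_mult'[symmetric]) auto
  finally show ?thesis
    using assms DIM_positive[where 'a='a] by (simp add: measure_def power_eq_if[of r "DIM('a)"])
qed

lemma integral_sphere_measure_const:
  fixes g :: "'a::euclidean_space \<Rightarrow> real"
  assumes "0 < r" "\<And>x. norm x = r \<Longrightarrow> g x = c"
  shows "(LINT x|sphere_measure r. g x) = real DIM('a) * unit_ball_vol (real DIM('a)) * r ^ (DIM('a) - 1) * c"
proof -
  have sp: "space (sphere_measure r :: 'a measure) = sphere 0 r"
    by (simp add: sphere_measure_def space_scale_measure space_restrict_space)
  have "(LINT x|sphere_measure r. g x) = (LINT x|(sphere_measure r :: 'a measure). c)"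
    by (rule Bochner_Integration.integral_cong) (auto simp: sp assms(2))
  then show ?thesis using measure_sphere_measure[OF assms(1), where 'a='a] by (simp add: sp)
qed

text \<open>For a radial function the norm of the gradient is the absolute value of the normal derivative, so the
  two quadratic terms with the factors \<open>- r / 2\<close> and \<open>r\<close> combine to one with the factor \<open>r / 2\<close>.\<close>

lemma pohozaev_radial:
  fixes f g :: "real \<Rightarrow> real"
  assumes r: "0 < r"
    and f: "(f has_real_derivative f') (at r)" and g: "(g has_real_derivative g') (at r)"
  shows "pohozaev \<mu>1 \<mu>2 \<beta> r (\<lambda>x. f (norm x)) (\<lambda>x. g (norm x)) = 4 * unit_ball_vol 4 * r ^ 3 *
    (f r * f' + r / 2 * f'\<^sup>2 + (g r * g' + r / 2 * g'\<^sup>2)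
      + r / 4 * (\<mu>1 * f r ^ 4 + \<mu>2 * g r ^ 4 + 2 * \<beta> * (f r)\<^sup>2 * (g r)\<^sup>2))" (is "_ = _ * ?c")
proof -
  let ?u = "\<lambda>x::real^4. f (norm x)" and ?v = "\<lambda>x::real^4. g (norm x)"
  have "pohozaev \<mu>1 \<mu>2 \<beta> r ?u ?v
    = real DIM(real^4) * unit_ball_vol (real DIM(real^4)) * r ^ (DIM(real^4) - 1) * ?c"
    unfolding pohozaev_def
  proof (rule integral_sphere_measure_const[OF r])
    fix x :: "real^4" assume x: "norm x = r"
    then have x0: "x \<noteq> 0" using r by auto
    have f': "(f has_real_derivative f') (at (norm x))" and g': "(g has_real_derivative g') (at (norm x))"
      using f g by (simp_all only: x)
    show "?u x * normal_deriv ?u x + ?v x * normal_deriv ?v x -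
       r / 2 * ((norm (grad ?u x))\<^sup>2 + (norm (grad ?v x))\<^sup>2) +
       r * \<bar>normal_deriv ?u x\<bar>\<^sup>2 + r * \<bar>normal_deriv ?v x\<bar>\<^sup>2 +
       r / 4 * (\<mu>1 * ?u x ^ 4 + \<mu>2 * ?v x ^ 4 + 2 * \<beta> * (?u x)\<^sup>2 * (?v x)\<^sup>2) = ?c"
      unfolding normal_deriv_radial[OF x0 f'] normal_deriv_radial[OF x0 g']
        norm_grad_radial[OF x0 f'] norm_grad_radial[OF x0 g'] x power2_abs
      by (simp only: distrib_left)
  qed
  then show ?thesis by simp
qed

section \<open>The Emden-Fowler substitution\<close>

text \<open>As in the locale below, \<open>U1\<close> and \<open>U2\<close> are the images of \<open>U\<close> under one and two applications of
  \<open>s d/ds\<close>; with \<open>s = c t^\<kappa>\<close> one has \<open>t d/dt = \<kappa> s d/ds\<close>.\<close>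

lemma emden_fowler_derivatives:
  fixes U U1 U2 :: "real \<Rightarrow> real" and c \<kappa> R s0 :: real
  assumes c: "0 < c" and range: "\<And>t. 0 < t \<Longrightarrow> t < R \<Longrightarrow> c * t powr \<kappa> < s0"
    and U: "\<And>s. 0 < s \<Longrightarrow> s < s0 \<Longrightarrow> (U has_real_derivative U1 s / s) (at s)"
    and U1: "\<And>s. 0 < s \<Longrightarrow> s < s0 \<Longrightarrow> (U1 has_real_derivative U2 s / s) (at s)"
    and U2: "continuous_on {0<..<s0} U2"
  defines "f \<equiv> \<lambda>t. U (c * t powr \<kappa>) / t"
    and "f1 \<equiv> \<lambda>t. (\<kappa> * U1 (c * t powr \<kappa>) - U (c * t powr \<kappa>)) / t\<^sup>2"
    and "f2 \<equiv> \<lambda>t. (\<kappa>\<^sup>2 * U2 (c * t powr \<kappa>) - 3 * \<kappa> * U1 (c * t powr \<kappa>) + 2 * U (c * t powr \<kappa>)) / t ^ 3"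
  shows "\<And>t. 0 < t \<Longrightarrow> t < R \<Longrightarrow> (f has_real_derivative f1 t) (at t)"
    and "\<And>t. 0 < t \<Longrightarrow> t < R \<Longrightarrow> (f1 has_real_derivative f2 t) (at t)"
    and "continuous_on {0<..<R} f2"
proof -
  define \<sigma> where "\<sigma> t = c * t powr \<kappa>" for t
  have \<sigma>: "0 < \<sigma> t" "\<sigma> t < s0" if "0 < t" "t < R" for t
    using that c range by (auto simp: \<sigma>_def)
  have d\<sigma>: "(\<sigma> has_real_derivative \<kappa> * \<sigma> t / t) (at t)" if "0 < t" for t
    unfolding \<sigma>_def[abs_def] using that
    by (auto intro!: derivative_eq_intros simp: powr_diff)
  have comp: "((\<lambda>t. H (\<sigma> t)) has_real_derivative \<kappa> * H' (\<sigma> t) / t) (at t)"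
    if "0 < t" "t < R" "\<And>s. 0 < s \<Longrightarrow> s < s0 \<Longrightarrow> (H has_real_derivative H' s / s) (at s)" for H H' t
    using DERIV_chain2[OF that(3)[OF \<sigma>[OF that(1,2)]] d\<sigma>[OF that(1)]] \<sigma>[OF that(1,2)] that
    by (simp add: mult.commute)
  show "(f has_real_derivative f1 t) (at t)" if t: "0 < t" "t < R" for t
    unfolding f_def f1_def \<sigma>_def[symmetric] using t
    by (auto intro!: derivative_eq_intros comp[OF t U] simp: power2_eq_square field_simps)
  show "(f1 has_real_derivative f2 t) (at t)" if t: "0 < t" "t < R" for t
    unfolding f1_def f2_def \<sigma>_def[symmetric] using t
    by (auto intro!: derivative_eq_intros comp[OF t U] comp[OF t U1]
        simp: power2_eq_square power3_eq_cube field_simps)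
  have c\<sigma>: "continuous_on {0<..<R} \<sigma>"
    by (rule DERIV_continuous_on) (auto intro: has_field_derivative_at_within d\<sigma>)
  have cc: "continuous_on {0<..<R} (\<lambda>t. H (\<sigma> t))" if "continuous_on {0<..<s0} H" for H :: "real \<Rightarrow> real"
    by (rule continuous_on_compose2[OF that c\<sigma>]) (auto simp: \<sigma>)
  have "continuous_on {0<..<s0} U" "continuous_on {0<..<s0} U1"
    by (rule DERIV_continuous_on; auto intro: has_field_derivative_at_within U U1)+
  then show "continuous_on {0<..<R} f2"
    unfolding f2_def \<sigma>_def[symmetric] by (intro continuous_intros cc U2) auto
qed

text \<open>The Pohozaev density of radial functions in the variables of the Emden-Fowler system.\<close>

lemma pohozaev_density_emden_fowler:
  fixes a a1 b b1 \<kappa> r :: real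
  assumes r: "0 < r"
  shows "a / r * ((\<kappa> * a1 - a) / r\<^sup>2) + r / 2 * ((\<kappa> * a1 - a) / r\<^sup>2)\<^sup>2
      + (b / r * ((\<kappa> * b1 - b) / r\<^sup>2) + r / 2 * ((\<kappa> * b1 - b) / r\<^sup>2)\<^sup>2)
      + r / 4 * (\<mu>1 * (a / r) ^ 4 + \<mu>2 * (b / r) ^ 4 + 2 * \<beta> * (a / r)\<^sup>2 * (b / r)\<^sup>2)
    = (\<kappa>\<^sup>2 * (a1\<^sup>2 + b1\<^sup>2) / 2 - (a\<^sup>2 + b\<^sup>2) / 2
      + (\<mu>1 * a ^ 4 + \<mu>2 * b ^ 4 + 2 * \<beta> * a\<^sup>2 * b\<^sup>2) / 4) / r ^ 3"
proof -
  have quad: "a / r * ((\<kappa> * a1 - a) / r\<^sup>2) + r / 2 * ((\<kappa> * a1 - a) / r\<^sup>2)\<^sup>2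
    = (\<kappa>\<^sup>2 * a1\<^sup>2 - a\<^sup>2) / 2 / r ^ 3" for a a1 :: real
  proof -
    have "r / 2 * ((\<kappa> * a1 - a) / r\<^sup>2)\<^sup>2 = (\<kappa> * a1 - a)\<^sup>2 / 2 / r ^ 3"
      using r by (simp add: power_divide power2_eq_square power3_eq_cube)
    moreover have "a / r * ((\<kappa> * a1 - a) / r\<^sup>2) = a * (\<kappa> * a1 - a) / r ^ 3"
      by (simp add: power2_eq_square power3_eq_cube)
    moreover have "a * (\<kappa> * a1 - a) + (\<kappa> * a1 - a)\<^sup>2 / 2 = (\<kappa>\<^sup>2 * a1\<^sup>2 - a\<^sup>2) / 2"
      by (simp add: power2_eq_square algebra_simps add_divide_distrib diff_divide_distrib)
    ultimately show ?thesis by (simp only: add_divide_distrib[symmetric])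
  qed
  have p4: "r / 4 * (c / r ^ 4) = c / 4 / r ^ 3" for c
    using r by (simp add: power4_eq_xxxx power3_eq_cube)
  have "\<mu>1 * (a / r) ^ 4 + \<mu>2 * (b / r) ^ 4 + 2 * \<beta> * (a / r)\<^sup>2 * (b / r)\<^sup>2
    = (\<mu>1 * a ^ 4 + \<mu>2 * b ^ 4 + 2 * \<beta> * a\<^sup>2 * b\<^sup>2) / r ^ 4"
    by (simp add: power_divide add_divide_distrib flip: power_add)
  then have "r / 4 * (\<mu>1 * (a / r) ^ 4 + \<mu>2 * (b / r) ^ 4 + 2 * \<beta> * (a / r)\<^sup>2 * (b / r)\<^sup>2)
    = (\<mu>1 * a ^ 4 + \<mu>2 * b ^ 4 + 2 * \<beta> * a\<^sup>2 * b\<^sup>2) / 4 / r ^ 3"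
    by (simp only: p4)
  moreover have "(\<kappa>\<^sup>2 * a1\<^sup>2 - a\<^sup>2) / 2 + (\<kappa>\<^sup>2 * b1\<^sup>2 - b\<^sup>2) / 2
    = \<kappa>\<^sup>2 * (a1\<^sup>2 + b1\<^sup>2) / 2 - (a\<^sup>2 + b\<^sup>2) / 2"
    by (simp add: algebra_simps add_divide_distrib diff_divide_distrib)
  ultimately show ?thesis unfolding quad by (simp only: add_divide_distrib[symmetric])
qed

section \<open>Profiles and the solutions they define\<close>

text \<open>A profile is a positive solution of the Emden-Fowler system that tends to the equilibrium
  \<open>(1 / sqrt \<mu>1, 0)\<close> as \<open>\<tau>\<close> grows, written as a function of a constant multiple \<open>s\<close> of \<open>exp (- \<kappa> \<tau>)\<close>.
  \<open>U1\<close>, \<open>U2\<close> and \<open>V1\<close>, \<open>V2\<close> are the images of \<open>U\<close> and \<open>V\<close> under one and two applications of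
  \<open>s d/ds\<close>, and \<open>\<kappa>^2\<close> is written out as \<open>1 - \<beta> / \<mu>1\<close>.\<close>

locale emden_fowler_profile =
  fixes \<mu>1 \<mu>2 \<beta> s0 :: real and U U1 U2 V V1 V2 :: "real \<Rightarrow> real"
  assumes mu1: "0 < \<mu>1" and beta: "\<beta> < \<mu>1" and s0: "0 < s0"
    and U: "\<And>s. 0 < s \<Longrightarrow> s < s0 \<Longrightarrow> (U has_real_derivative U1 s / s) (at s)"
    and U1: "\<And>s. 0 < s \<Longrightarrow> s < s0 \<Longrightarrow> (U1 has_real_derivative U2 s / s) (at s)"
    and V: "\<And>s. 0 < s \<Longrightarrow> s < s0 \<Longrightarrow> (V has_real_derivative V1 s / s) (at s)"
    and V1: "\<And>s. 0 < s \<Longrightarrow> s < s0 \<Longrightarrow> (V1 has_real_derivative V2 s / s) (at s)"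
    and c2: "continuous_on {0<..<s0} U2" "continuous_on {0<..<s0} V2"
    and lims: "(U \<longlongrightarrow> 1 / sqrt \<mu>1) (at_right 0)" "(U1 \<longlongrightarrow> 0) (at_right 0)"
      "(V \<longlongrightarrow> 0) (at_right 0)" "(V1 \<longlongrightarrow> 0) (at_right 0)"
    and pos: "\<And>s. 0 < s \<Longrightarrow> s < s0 \<Longrightarrow> 0 < U s" "\<And>s. 0 < s \<Longrightarrow> s < s0 \<Longrightarrow> 0 < V s"
    and odeU: "\<And>s. 0 < s \<Longrightarrow> s < s0 \<Longrightarrow> (1 - \<beta> / \<mu>1) * U2 s = U s - \<mu>1 * U s ^ 3 - \<beta> * U s * (V s)\<^sup>2"
    and odeV: "\<And>s. 0 < s \<Longrightarrow> s < s0 \<Longrightarrow> (1 - \<beta> / \<mu>1) * V2 s = V s - \<mu>2 * V s ^ 3 - \<beta> * V s * (U s)\<^sup>2"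
begin

text \<open>The decay rate of \<open>V\<close> in \<open>\<tau>\<close>.\<close>

definition \<kappa> where "\<kappa> = sqrt (1 - \<beta> / \<mu>1)"

text \<open>The change of variables \<open>s = c t^\<kappa>\<close>, with the factor for which \<open>t < 2\<close> corresponds to \<open>s < s0\<close>.\<close>

definition \<sigma> where "\<sigma> t = s0 / 2 powr \<kappa> * t powr \<kappa>"

text \<open>The radial functions defined by \<open>U\<close> and \<open>V\<close>, with their first and second derivatives.\<close>

definition f where "f t = U (\<sigma> t) / t"
definition f1 where "f1 t = (\<kappa> * U1 (\<sigma> t) - U (\<sigma> t)) / t\<^sup>2"
definition f2 where "f2 t = (\<kappa>\<^sup>2 * U2 (\<sigma> t) - 3 * \<kappa> * U1 (\<sigma> t) + 2 * U (\<sigma> t)) / t ^ 3"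
definition g where "g t = V (\<sigma> t) / t"
definition g1 where "g1 t = (\<kappa> * V1 (\<sigma> t) - V (\<sigma> t)) / t\<^sup>2"
definition g2 where "g2 t = (\<kappa>\<^sup>2 * V2 (\<sigma> t) - 3 * \<kappa> * V1 (\<sigma> t) + 2 * V (\<sigma> t)) / t ^ 3"

definition u :: "real^4 \<Rightarrow> real" where "u x = f (norm x)"
definition v :: "real^4 \<Rightarrow> real" where "v x = g (norm x)"

lemma \<kappa>: "0 < \<kappa>" "\<kappa>\<^sup>2 = 1 - \<beta> / \<mu>1"
  using mu1 beta by (auto simp: \<kappa>_def)

lemma \<sigma>:
  assumes "0 < t" "t < 2"
  shows "0 < \<sigma> t" "\<sigma> t < s0"
proof -
  have c: "0 < s0 / 2 powr \<kappa>" using s0 by simp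
  then have "s0 / 2 powr \<kappa> * t powr \<kappa> < s0 / 2 powr \<kappa> * 2 powr \<kappa>"
    using assms \<kappa>(1) by (intro mult_strict_left_mono powr_less_mono2) simp_all
  then show "0 < \<sigma> t" "\<sigma> t < s0" using assms(1) c s0 by (simp_all add: \<sigma>_def)
qed

lemma f_derivatives:
  shows "\<And>t. 0 < t \<Longrightarrow> t < 2 \<Longrightarrow> (f has_real_derivative f1 t) (at t)"
    and "\<And>t. 0 < t \<Longrightarrow> t < 2 \<Longrightarrow> (f1 has_real_derivative f2 t) (at t)"
    and "continuous_on {0<..<2} f2"
proof -
  have c: "0 < s0 / 2 powr \<kappa>" using s0 by simp
  note D = emden_fowler_derivatives[OF c \<sigma>(2)[unfolded \<sigma>_def] U U1 c2(1)]
  show "\<And>t. 0 < t \<Longrightarrow> t < 2 \<Longrightarrow> (f has_real_derivative f1 t) (at t)"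
    and "\<And>t. 0 < t \<Longrightarrow> t < 2 \<Longrightarrow> (f1 has_real_derivative f2 t) (at t)"
    and "continuous_on {0<..<2} f2"
    unfolding f_def[abs_def] f1_def[abs_def] f2_def[abs_def] \<sigma>_def by (rule D; assumption)+
qed

lemma g_derivatives:
  shows "\<And>t. 0 < t \<Longrightarrow> t < 2 \<Longrightarrow> (g has_real_derivative g1 t) (at t)"
    and "\<And>t. 0 < t \<Longrightarrow> t < 2 \<Longrightarrow> (g1 has_real_derivative g2 t) (at t)"
    and "continuous_on {0<..<2} g2"
proof -
  have c: "0 < s0 / 2 powr \<kappa>" using s0 by simp
  note D = emden_fowler_derivatives[OF c \<sigma>(2)[unfolded \<sigma>_def] V V1 c2(2)]
  show "\<And>t. 0 < t \<Longrightarrow> t < 2 \<Longrightarrow> (g has_real_derivative g1 t) (at t)"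
    and "\<And>t. 0 < t \<Longrightarrow> t < 2 \<Longrightarrow> (g1 has_real_derivative g2 t) (at t)"
    and "continuous_on {0<..<2} g2"
    unfolding g_def[abs_def] g1_def[abs_def] g2_def[abs_def] \<sigma>_def by (rule D; assumption)+
qed

text \<open>The energy is constant by the equations, and its value is read off from the limit at \<open>s = 0\<close>.\<close>

lemma energy:
  assumes s: "0 < s" "s < s0"
  shows "(1 - \<beta> / \<mu>1) * ((U1 s)\<^sup>2 + (V1 s)\<^sup>2) / 2 - ((U s)\<^sup>2 + (V s)\<^sup>2) / 2
     + (\<mu>1 * U s ^ 4 + \<mu>2 * V s ^ 4 + 2 * \<beta> * (U s)\<^sup>2 * (V s)\<^sup>2) / 4 = - 1 / (4 * \<mu>1)"
proof -
  define k where "k = 1 - \<beta> / \<mu>1"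
  note odes = odeU[folded k_def] odeV[folded k_def]
  define E where "E s = k * ((U1 s)\<^sup>2 + (V1 s)\<^sup>2) / 2 - ((U s)\<^sup>2 + (V s)\<^sup>2) / 2
     + (\<mu>1 * U s ^ 4 + \<mu>2 * V s ^ 4 + 2 * \<beta> * (U s)\<^sup>2 * (V s)\<^sup>2) / 4" for s
  have der: "(E has_real_derivative 0) (at t)" if t: "0 < t" "t < s0" for t
  proof -
    have "(E has_real_derivative
      k * (2 * U1 t * (U2 t / t) + 2 * V1 t * (V2 t / t)) / 2 - (2 * U t * (U1 t / t) + 2 * V t * (V1 t / t)) / 2
      + (\<mu>1 * (4 * U t ^ 3 * (U1 t / t)) + \<mu>2 * (4 * V t ^ 3 * (V1 t / t))
        + 2 * \<beta> * (2 * U t * (U1 t / t) * (V t)\<^sup>2 + (U t)\<^sup>2 * (2 * V t * (V1 t / t)))) / 4) (at t)"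
      unfolding E_def[abs_def]
      by (auto intro!: derivative_eq_intros U[OF t] U1[OF t] V[OF t] V1[OF t] simp: algebra_simps add_divide_distrib)
    also have "k * (2 * U1 t * (U2 t / t) + 2 * V1 t * (V2 t / t)) / 2 - (2 * U t * (U1 t / t) + 2 * V t * (V1 t / t)) / 2
      + (\<mu>1 * (4 * U t ^ 3 * (U1 t / t)) + \<mu>2 * (4 * V t ^ 3 * (V1 t / t))
        + 2 * \<beta> * (2 * U t * (U1 t / t) * (V t)\<^sup>2 + (U t)\<^sup>2 * (2 * V t * (V1 t / t)))) / 4
      = (U1 t / t) * (k * U2 t - (U t - \<mu>1 * U t ^ 3 - \<beta> * U t * (V t)\<^sup>2))
      + (V1 t / t) * (k * V2 t - (V t - \<mu>2 * V t ^ 3 - \<beta> * V t * (U t)\<^sup>2))"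
      by (simp add: algebra_simps add_divide_distrib)
    finally show ?thesis using odes(1)[OF t] odes(2)[OF t] by simp
  qed
  have "\<exists>C. \<forall>t\<in>{0<..<s0}. E t = C"
    by (rule has_field_derivative_zero_constant) (auto intro: has_field_derivative_at_within der)
  then obtain C where C: "\<And>t. 0 < t \<Longrightarrow> t < s0 \<Longrightarrow> E t = C" by auto
  have "(E \<longlongrightarrow> k * (0\<^sup>2 + 0\<^sup>2) / 2 - ((1 / sqrt \<mu>1)\<^sup>2 + 0\<^sup>2) / 2
     + (\<mu>1 * (1 / sqrt \<mu>1) ^ 4 + \<mu>2 * 0 ^ 4 + 2 * \<beta> * (1 / sqrt \<mu>1)\<^sup>2 * 0\<^sup>2) / 4) (at_right 0)"
    unfolding E_def[abs_def] by (intro tendsto_intros lims) auto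
  moreover have "sqrt \<mu>1 ^ 4 = \<mu>1\<^sup>2"
    using mu1 power_mult[of "sqrt \<mu>1" 2 2] by simp
  ultimately have "(E \<longlongrightarrow> - 1 / (4 * \<mu>1)) (at_right 0)"
    using mu1 by (simp add: power_divide power2_eq_square field_simps)
  moreover have "eventually (\<lambda>t. E t = C) (at_right 0)"
    unfolding eventually_at_right_field using C s by (intro exI[of _ s0]) auto
  ultimately have "((\<lambda>_. C) \<longlongrightarrow> - 1 / (4 * \<mu>1)) (at_right (0::real))"
    by (rule Lim_transform_eventually)
  then have "C = - 1 / (4 * \<mu>1)"
    by (simp add: tendsto_const_iff)
  with C[OF s] show ?thesis by (simp add: E_def k_def)
qed

text \<open>The terms of first order cancel in \<open>f'' + 3 f' / t\<close>, because the dimension is 4.\<close>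

lemma laplacian_uv:
  fixes x :: "real^4"
  assumes x: "x \<in> ball 0 2 - {0}"
  shows "laplacian u x = (\<kappa>\<^sup>2 * U2 (\<sigma> (norm x)) - U (\<sigma> (norm x))) / norm x ^ 3"
    and "laplacian v x = (\<kappa>\<^sup>2 * V2 (\<sigma> (norm x)) - V (\<sigma> (norm x))) / norm x ^ 3"
proof -
  have comb: "(a - 3 * b + 2 * e) / t ^ 3 + 3 * ((b - e) / t\<^sup>2) / t = (a - e) / t ^ 3" for a b e t :: real
  proof -
    have "3 * ((b - e) / t\<^sup>2) / t = (3 * (b - e)) / t ^ 3"
      by (simp only: power2_eq_square power3_eq_cube times_divide_eq_right divide_divide_eq_left)
    moreover have "a - 3 * b + 2 * e + 3 * (b - e) = a - e" by simp
    ultimately show ?thesis by (simp only: add_divide_distrib[symmetric])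
  qed
  show "laplacian u x = (\<kappa>\<^sup>2 * U2 (\<sigma> (norm x)) - U (\<sigma> (norm x))) / norm x ^ 3"
    using radial_C2_laplacian(2)[OF f_derivatives x] comb[of _ "\<kappa> * U1 (\<sigma> (norm x))"]
    by (simp add: u_def[abs_def] f1_def f2_def mult.assoc)
  show "laplacian v x = (\<kappa>\<^sup>2 * V2 (\<sigma> (norm x)) - V (\<sigma> (norm x))) / norm x ^ 3"
    using radial_C2_laplacian(2)[OF g_derivatives x] comb[of _ "\<kappa> * V1 (\<sigma> (norm x))"]
    by (simp add: v_def[abs_def] g1_def g2_def mult.assoc)
qed

lemma positive_solution: "is_positive_solution \<mu>1 \<mu>2 \<beta> u v"
  unfolding is_positive_solution_def
proof (intro conjI ballI)
  show "C2_on (ball 0 2 - {0}) u" "C2_on (ball 0 2 - {0}) v"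
    using radial_C2_laplacian(1)[OF f_derivatives, where 'a="real^4"]
      radial_C2_laplacian(1)[OF g_derivatives, where 'a="real^4"]
    by (simp_all add: u_def[abs_def] v_def[abs_def])
  fix x :: "real^4" assume x: "x \<in> ball 0 2 - {0}"
  then have n: "0 < norm x" "norm x < 2" by auto
  note s = \<sigma>[OF n]
  show "0 < u x" "0 < v x"
    using n pos[OF s] by (simp_all add: u_def v_def f_def g_def)
  show "- laplacian u x = \<mu>1 * u x ^ 3 + \<beta> * u x * (v x)\<^sup>2"
    unfolding laplacian_uv[OF x] \<kappa>(2) odeU[OF s] u_def v_def f_def g_def
    by (simp add: power_divide power2_eq_square power3_eq_cube add_divide_distrib diff_divide_distrib)
  show "- laplacian v x = \<mu>2 * v x ^ 3 + \<beta> * v x * (u x)\<^sup>2"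
    unfolding laplacian_uv[OF x] \<kappa>(2) odeV[OF s] u_def v_def f_def g_def
    by (simp add: power_divide power2_eq_square power3_eq_cube add_divide_distrib diff_divide_distrib)
qed

lemma pohozaev_uv:
  assumes r: "0 < r" "r < 2"
  shows "pohozaev \<mu>1 \<mu>2 \<beta> r u v = - unit_ball_vol 4 / \<mu>1"
proof -
  have "pohozaev \<mu>1 \<mu>2 \<beta> r u v = 4 * unit_ball_vol 4 * r ^ 3 *
    (f r * f1 r + r / 2 * (f1 r)\<^sup>2 + (g r * g1 r + r / 2 * (g1 r)\<^sup>2)
      + r / 4 * (\<mu>1 * f r ^ 4 + \<mu>2 * g r ^ 4 + 2 * \<beta> * (f r)\<^sup>2 * (g r)\<^sup>2))"
    unfolding u_def[abs_def] v_def[abs_def]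
    by (rule pohozaev_radial[OF r(1) f_derivatives(1)[OF r] g_derivatives(1)[OF r]])
  also have "\<dots> = 4 * unit_ball_vol 4 * r ^ 3 * (- 1 / (4 * \<mu>1) / r ^ 3)"
    unfolding f_def f1_def g_def g1_def pohozaev_density_emden_fowler[OF r(1)] \<kappa>(2) energy[OF \<sigma>[OF r]] ..
  finally show ?thesis using r by simp
qed

lemma limits:
  shows "((\<lambda>x. norm x * u x) \<longlongrightarrow> 1 / sqrt \<mu>1) (at 0)"
    and "((\<lambda>x. norm x * v x) \<longlongrightarrow> 0) (at 0)"
proof -
  have "filterlim \<sigma> (at_right 0) (at_right 0)"
  proof (rule filterlim_at_withinI)
    have "((\<lambda>t. s0 / 2 powr \<kappa> * t powr \<kappa>) \<longlongrightarrow> s0 / 2 powr \<kappa> * 0 powr \<kappa>) (at_right 0)"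
      using \<kappa>(1) by (intro tendsto_intros tendsto_powr') (auto simp: eventually_at_filter)
    then show "(\<sigma> \<longlongrightarrow> 0) (at_right 0)" using \<kappa>(1) by (simp add: \<sigma>_def[abs_def])
    show "eventually (\<lambda>t. \<sigma> t \<in> {0<..} - {0}) (at_right 0)"
      unfolding eventually_at_right_field using \<sigma>(1) by (intro exI[of _ 2]) auto
  qed
  moreover have "filterlim norm (at_right 0) (at (0::real^4))"
    by (rule filterlim_at_withinI)
      (auto intro!: tendsto_norm_zero tendsto_ident_at simp: eventually_at_filter)
  ultimately have \<sigma>lim: "filterlim (\<lambda>x::real^4. \<sigma> (norm x)) (at_right 0) (at 0)"
    by (rule filterlim_compose)
  have lim: "((\<lambda>x::real^4. norm x * (H (\<sigma> (norm x)) / norm x)) \<longlongrightarrow> l) (at 0)"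
    if "(H \<longlongrightarrow> l) (at_right 0)" for H l
    by (rule Lim_transform_eventually[OF filterlim_compose[OF that \<sigma>lim]])
      (auto simp: eventually_at_filter)
  show "((\<lambda>x. norm x * u x) \<longlongrightarrow> 1 / sqrt \<mu>1) (at 0)" "((\<lambda>x. norm x * v x) \<longlongrightarrow> 0) (at 0)"
    unfolding u_def v_def f_def g_def by (intro lim lims)+
qed

lemma v_not_bounded_below: "\<not> (\<exists>C1>0. eventually (\<lambda>x. v x \<ge> C1 * inverse (norm x)) (at 0))"
proof
  assume "\<exists>C1>0. eventually (\<lambda>x. v x \<ge> C1 * inverse (norm x)) (at 0)"
  then obtain C1 where C1: "0 < C1" "eventually (\<lambda>x. v x \<ge> C1 * inverse (norm x)) (at 0)" by blast
  have "eventually (\<lambda>x. C1 \<le> norm x * v x) (at 0)"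
    using C1(2) eventually_neq_at_within[of 0]
    by eventually_elim (simp add: field_simps)
  then have "C1 \<le> 0" by (rule tendsto_lowerbound[OF limits(2)]) simp
  with C1 show False by simp
qed

lemma singular_solution:
  "\<exists>(u :: real^4 \<Rightarrow> real) v.
    is_positive_solution \<mu>1 \<mu>2 \<beta> u v \<and>
    radially_symmetric_on (ball 0 2 - {0}) u \<and> radially_symmetric_on (ball 0 2 - {0}) v \<and>
    (\<exists>D<0. \<forall>r. 0 < r \<and> r < 2 \<longrightarrow> pohozaev \<mu>1 \<mu>2 \<beta> r u v = D) \<and>
    ((\<lambda>x. norm x * u x) \<longlongrightarrow> 1 / sqrt \<mu>1) (at 0) \<and>
    ((\<lambda>x. norm x * v x) \<longlongrightarrow> 0) (at 0) \<and>
    \<not> (\<exists>C1>0. eventually (\<lambda>x. v x \<ge> C1 * inverse (norm x)) (at 0))"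
proof -
  have "radially_symmetric_on (ball 0 2 - {0}) u" "radially_symmetric_on (ball 0 2 - {0}) v"
    by (simp_all add: radially_symmetric_on_def u_def v_def)
  moreover have "- unit_ball_vol 4 / \<mu>1 < 0" using mu1 by simp
  ultimately show ?thesis
    using positive_solution pohozaev_uv limits v_not_bounded_below by blast
qed

end

section \<open>Recursively determined pairs of power series\<close>

text \<open>Congruence of power series modulo \<open>X^n\<close>: the coefficients of index below \<open>n\<close> coincide.\<close>

definition agree :: "nat \<Rightarrow> 'a fps \<Rightarrow> 'a fps \<Rightarrow> bool" where
  "agree n F G \<longleftrightarrow> (\<forall>i<n. fps_nth F i = fps_nth G i)"

lemma agree_refl [simp]: "agree n F F"
  by (simp add: agree_def)

lemma agree_add: "agree n F F' \<Longrightarrow> agree n G G' \<Longrightarrow> agree n (F + G) (F' + G')"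
  for F :: "'a::monoid_add fps"
  by (simp add: agree_def)

lemma agree_uminus: "agree n F F' \<Longrightarrow> agree n (- F) (- F')" for F :: "'a::group_add fps"
  by (simp add: agree_def)

lemma agree_mult: "agree n F F' \<Longrightarrow> agree n G G' \<Longrightarrow> agree n (F * G) (F' * G')"
  for F :: "'a::comm_ring_1 fps"
  by (auto simp: agree_def fps_mult_nth intro!: sum.cong)

text \<open>For factors without constant term, a product is known to one order more than the factors are.\<close>

lemma agree_mult_Suc:
  fixes F :: "'a::comm_ring_1 fps"
  assumes "agree n F F'" "agree n G G'"
    and "fps_nth F 0 = 0" "fps_nth F' 0 = 0" "fps_nth G 0 = 0" "fps_nth G' 0 = 0"
  shows "agree (Suc n) (F * G) (F' * G')"
  unfolding agree_def fps_mult_nth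
proof (intro allI impI sum.cong refl)
  fix i j assume "i < Suc n" "j \<in> {0..i}"
  then consider "j = 0" | "j = i" | "j < n" "i - j < n" by fastforce
  then show "fps_nth F j * fps_nth G (i - j) = fps_nth F' j * fps_nth G' (i - j)"
    using assms by cases (auto simp: agree_def)
qed

text \<open>On series without constant term, the coefficient of index \<open>n\<close> of a causal operator depends only on
  the coefficients of the arguments of index below \<open>n\<close>.\<close>

definition causal :: "('a::zero fps \<Rightarrow> 'a fps \<Rightarrow> 'a fps) \<Rightarrow> bool" where
  "causal Q \<longleftrightarrow> (\<forall>n F F' G G'. agree n F F' \<longrightarrow> agree n G G' \<longrightarrow>
     fps_nth F 0 = 0 \<longrightarrow> fps_nth F' 0 = 0 \<longrightarrow> fps_nth G 0 = 0 \<longrightarrow> fps_nth G' 0 = 0 \<longrightarrow>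
     agree (Suc n) (Q F G) (Q F' G'))"

lemma causalD:
  "causal Q \<Longrightarrow> agree n F F' \<Longrightarrow> agree n G G' \<Longrightarrow> fps_nth F 0 = 0 \<Longrightarrow> fps_nth F' 0 = 0 \<Longrightarrow>
   fps_nth G 0 = 0 \<Longrightarrow> fps_nth G' 0 = 0 \<Longrightarrow> agree (Suc n) (Q F G) (Q F' G')"
  unfolding causal_def by blast

text \<open>The coefficients are defined by well-founded recursion on the index. The coefficients of index 0
  and 1 are prescribed, the two equations apply from index 2 on.\<close>

lemma fps_pair_recursion:
  fixes Q1 Q2 :: "real fps \<Rightarrow> real fps \<Rightarrow> real fps" and d1 d2 :: "nat \<Rightarrow> real"
  assumes Q: "causal Q1" "causal Q2"
  obtains F G where "fps_nth F 0 = 0" "fps_nth F 1 = 0" "fps_nth G 0 = 0" "fps_nth G 1 = 1"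
    "\<And>n. 2 \<le> n \<Longrightarrow> fps_nth F n = fps_nth (Q1 F G) n / d1 n"
    "\<And>n. 2 \<le> n \<Longrightarrow> fps_nth G n = fps_nth (Q2 F G) n / d2 n"
proof -
  \<comment> \<open>Resetting the constant term to 0 makes causality applicable to arbitrary sequences.\<close>
  define S where "S h = Abs_fps (\<lambda>n. if n = 0 then 0 else h n)" for h :: "nat \<Rightarrow> real"
  define T where "T p n = (if n = 0 then (0, 0) else if n = 1 then (0, 1) else
     (fps_nth (Q1 (S (fst \<circ> p)) (S (snd \<circ> p))) n / d1 n,
      fps_nth (Q2 (S (fst \<circ> p)) (S (snd \<circ> p))) n / d2 n))" for p :: "nat \<Rightarrow> real \<times> real" and n
  have adm: "adm_wf less_than T"
    unfolding adm_wf_def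
  proof (intro allI impI)
    fix p q :: "nat \<Rightarrow> real \<times> real" and n
    assume pq: "\<forall>z. (z, n) \<in> less_than \<longrightarrow> p z = q z"
    have 1: "agree n (S (fst \<circ> p)) (S (fst \<circ> q))" "agree n (S (snd \<circ> p)) (S (snd \<circ> q))"
      using pq by (auto simp: agree_def S_def)
    have 0: "fps_nth (S h) 0 = 0" for h by (simp add: S_def)
    from causalD[OF Q(1) 1 0 0 0 0] causalD[OF Q(2) 1 0 0 0 0]
    show "T p n = T q n" by (simp add: T_def agree_def)
  qed
  define p where "p = wfrec less_than T"
  have p: "p = T p"
    unfolding p_def by (rule wfrec_fixpoint[OF wf_less_than adm])
  define F where "F = S (fst \<circ> p)"
  define G where "G = S (snd \<circ> p)"
  have nth: "fps_nth F n = fst (T p n)" "fps_nth G n = snd (T p n)" for n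
    by (subst p[symmetric]; simp add: F_def G_def S_def; subst p; simp add: T_def)+
  show thesis
    by (rule that[of F G]) (simp_all add: nth, simp_all add: T_def F_def[symmetric] G_def[symmetric])
qed

section \<open>A weighted coefficient bound\<close>

text \<open>Partial sums of the weighted absolute coefficient sum; for fixed \<open>N\<close> and \<open>r \<ge> 0\<close> this is a
  submultiplicative seminorm.\<close>

definition psum :: "real \<Rightarrow> nat \<Rightarrow> real fps \<Rightarrow> real" where
  "psum r N F = (\<Sum>n\<le>N. \<bar>fps_nth F n\<bar> * r ^ n)"

lemma psum_nonneg: "0 \<le> r \<Longrightarrow> 0 \<le> psum r N F"
  by (simp add: psum_def sum_nonneg)

lemma psum_const: "psum r N (fps_const c) = \<bar>c\<bar>"
proof -
  have "psum r N (fps_const c) = (\<Sum>n\<le>N. if n = 0 then \<bar>c\<bar> else 0)"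
    unfolding psum_def by (intro sum.cong) auto
  then show ?thesis by simp
qed

lemma psum_uminus [simp]: "psum r N (- F) = psum r N F"
  by (simp add: psum_def)

lemma psum_add: "0 \<le> r \<Longrightarrow> psum r N (F + G) \<le> psum r N F + psum r N G"
  unfolding psum_def sum.distrib[symmetric]
  by (intro sum_mono) (simp add: distrib_right[symmetric] mult_right_mono abs_triangle_ineq)

lemma psum_mult:
  assumes r: "0 \<le> r"
  shows "psum r N (F * G) \<le> psum r N F * psum r N G"
proof -
  let ?f = "\<lambda>i j. (\<bar>fps_nth F i\<bar> * r ^ i) * (\<bar>fps_nth G j\<bar> * r ^ j)"
  have "psum r N (F * G) \<le> (\<Sum>n\<le>N. \<Sum>i\<le>n. ?f i (n - i))"
    unfolding psum_def
  proof (intro sum_mono)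
    fix n
    have "\<bar>fps_nth (F * G) n\<bar> * r ^ n \<le> (\<Sum>i\<le>n. \<bar>fps_nth F i * fps_nth G (n - i)\<bar>) * r ^ n"
      unfolding fps_mult_nth atLeast0AtMost by (intro mult_right_mono sum_abs) (use r in auto)
    also have "\<dots> = (\<Sum>i\<le>n. ?f i (n - i))"
      unfolding sum_distrib_right
    proof (intro sum.cong refl)
      fix i assume "i \<in> {..n}"
      then have "r ^ n = r ^ i * r ^ (n - i)" by (simp flip: power_add)
      then show "\<bar>fps_nth F i * fps_nth G (n - i)\<bar> * r ^ n = ?f i (n - i)"
        by (simp add: abs_mult)
    qed
    finally show "\<bar>fps_nth (F * G) n\<bar> * r ^ n \<le> (\<Sum>i\<le>n. ?f i (n - i))" .
  qed
  also have "\<dots> = (\<Sum>(i, j)\<in>{(i, j). i + j < Suc N}. ?f i j)"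
    unfolding lessThan_Suc_atMost[symmetric] sum.triangle_reindex
    by (simp add: lessThan_Suc_atMost)
  also have "\<dots> \<le> (\<Sum>(i, j)\<in>{..N} \<times> {..N}. ?f i j)"
    by (intro sum_mono2) (use r in auto)
  also have "\<dots> = psum r N F * psum r N G"
    by (simp add: psum_def sum_product sum.cartesian_product)
  finally show ?thesis .
qed

lemma psum_mult_le:
  assumes "0 \<le> r" "psum r N F \<le> a" "psum r N G \<le> b"
  shows "psum r N (F * G) \<le> a * b"
proof -
  have "psum r N F * psum r N G \<le> a * b"
    using assms psum_nonneg[OF assms(1)] by (intro mult_mono) (auto intro: order_trans)
  with psum_mult[OF assms(1)] show ?thesis by (rule order_trans)
qed

lemma psum_add_le:
  "0 \<le> r \<Longrightarrow> psum r N F \<le> a \<Longrightarrow> psum r N G \<le> b \<Longrightarrow> psum r N (F + G) \<le> a + b"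
  using psum_add[of r N F G] by linarith

text \<open>Induction on \<open>N\<close>: by causality the right-hand sides up to index \<open>N + 1\<close> are those of the series
  truncated after index \<open>N\<close>, for which the bound is already known. The summand \<open>r\<close> that is subtracted
  in the bound of \<open>Q2\<close> leaves room for the prescribed coefficient \<open>G_1 = 1\<close>.\<close>

lemma psum_recursion_bound:
  fixes Q1 Q2 :: "real fps \<Rightarrow> real fps \<Rightarrow> real fps" and d1 d2 :: "nat \<Rightarrow> real"
  assumes Q: "causal Q1" "causal Q2"
    and b1: "\<And>N F G. psum r N F \<le> \<delta> \<Longrightarrow> psum r N G \<le> \<delta> \<Longrightarrow> psum r N (Q1 F G) \<le> m1 * \<delta>"
    and b2: "\<And>N F G. psum r N F \<le> \<delta> \<Longrightarrow> psum r N G \<le> \<delta> \<Longrightarrow> psum r N (Q2 F G) \<le> m2 * (\<delta> - r)"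
    and m: "0 < m1" "0 < m2" "\<And>n. 2 \<le> n \<Longrightarrow> m1 \<le> d1 n" "\<And>n. 2 \<le> n \<Longrightarrow> m2 \<le> d2 n"
    and r: "0 \<le> r" "r \<le> \<delta>"
    and F: "fps_nth F 0 = 0" "fps_nth F 1 = 0" and G: "fps_nth G 0 = 0" "fps_nth G 1 = 1"
    and rec: "\<And>n. 2 \<le> n \<Longrightarrow> fps_nth F n = fps_nth (Q1 F G) n / d1 n"
    "\<And>n. 2 \<le> n \<Longrightarrow> fps_nth G n = fps_nth (Q2 F G) n / d2 n"
  shows "psum r N F \<le> \<delta> \<and> psum r N G \<le> \<delta>"
proof (induction N)
  case 0
  then show ?case using r F G by (simp add: psum_def)
next
  case (Suc N)
  let ?F = "fps_cutoff (Suc N) F" and ?G = "fps_cutoff (Suc N) G"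
  have cut: "psum r (Suc N) (fps_cutoff (Suc N) H) = psum r N H" for H
    unfolding psum_def sum.atMost_Suc by (simp cong: sum.cong_simp)
  have ag: "agree (Suc N) F ?F" "agree (Suc N) G ?G" by (auto simp: agree_def)
  have eq: "psum r (Suc N) H = psum r (Suc N) H'" if "agree (Suc (Suc N)) H H'" for H H'
    unfolding psum_def using that by (intro sum.cong) (auto simp: agree_def)
  have q1: "psum r (Suc N) (Q1 F G) \<le> m1 * \<delta>"
    using eq[OF causalD[OF Q(1) ag]] b1[of "Suc N" ?F ?G] Suc F G by (simp add: cut)
  have q2: "psum r (Suc N) (Q2 F G) \<le> m2 * (\<delta> - r)"
    using eq[OF causalD[OF Q(2) ag]] b2[of "Suc N" ?F ?G] Suc F G by (simp add: cut)
  have quot: "\<bar>q / d\<bar> * r ^ n \<le> \<bar>q\<bar> * r ^ n / m" if "0 < m" "m \<le> d" for q d m n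
  proof -
    have "\<bar>q / d\<bar> \<le> \<bar>q\<bar> / m" using that by (auto simp: abs_divide intro!: divide_left_mono)
    then show ?thesis using r by (metis mult_right_mono times_divide_eq_left zero_le_power)
  qed
  have t1: "\<bar>fps_nth F n\<bar> * r ^ n \<le> \<bar>fps_nth (Q1 F G) n\<bar> * r ^ n / m1" for n
  proof (cases "2 \<le> n")
    case True
    show ?thesis using quot[OF m(1) m(3)[OF True]] rec(1)[OF True] by simp
  next
    case False
    then have "n = 0 \<or> n = 1" by auto
    then show ?thesis using F m r by auto
  qed
  have t2: "\<bar>fps_nth G n\<bar> * r ^ n \<le> (if n = 1 then r else 0) + \<bar>fps_nth (Q2 F G) n\<bar> * r ^ n / m2" for n
  proof (cases "2 \<le> n")
    case True
    show ?thesis using quot[OF m(2) m(4)[OF True]] rec(2)[OF True] True by simp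
  next
    case False
    then have "n = 0 \<or> n = 1" by auto
    then show ?thesis using G m r by auto
  qed
  have "psum r (Suc N) F \<le> psum r (Suc N) (Q1 F G) / m1"
    unfolding psum_def sum_divide_distrib by (intro sum_mono t1)
  also have "\<dots> \<le> \<delta>" using q1 m by (simp add: field_simps)
  finally have 1: "psum r (Suc N) F \<le> \<delta>" .
  have "psum r (Suc N) G \<le> (\<Sum>n\<le>Suc N. if n = 1 then r else 0) + psum r (Suc N) (Q2 F G) / m2"
    unfolding psum_def sum_divide_distrib sum.distrib[symmetric] by (intro sum_mono t2)
  also have "(\<Sum>n\<le>Suc N. if n = 1 then r else 0) = r" by simp
  also have "r + psum r (Suc N) (Q2 F G) / m2 \<le> \<delta>" using q2 m by (simp add: field_simps)
  finally show ?case using 1 by simp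
qed

lemma fps_conv_radius_ge_psum:
  assumes "0 \<le> r" "\<And>N. psum r N F \<le> \<delta>"
  shows "ereal r \<le> fps_conv_radius F"
proof -
  have "summable (\<lambda>n. \<bar>fps_nth F n * r ^ n\<bar>)"
  proof (rule bounded_imp_summable[where B=\<delta>])
    show "(\<Sum>k\<le>n. \<bar>fps_nth F k * r ^ k\<bar>) \<le> \<delta>" for n
      using assms by (simp add: psum_def abs_mult)
  qed simp
  then have "summable (\<lambda>n. fps_nth F n * r ^ n)" by (rule summable_rabs_cancel)
  from conv_radius_geI[OF this] assms(1) show ?thesis by (simp add: fps_conv_radius_def)
qed

section \<open>The formal solution of the system\<close>

text \<open>The Euler operator \<open>X d/dX\<close>; it multiplies the coefficient of index \<open>n\<close> by \<open>n\<close>.\<close>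

abbreviation fps_euler :: "real fps \<Rightarrow> real fps" where
  "fps_euler F \<equiv> fps_X * fps_deriv F"

text \<open>The right-hand sides of the equations for the coefficients of \<open>W\<close> and \<open>V\<close>, where \<open>\<mu>\<close> is \<open>\<mu>2\<close> and
  \<open>\<gamma>\<close> is \<open>\<beta> / \<mu>1\<close>. They are written as sums of products of two factors that have no constant term
  if \<open>W\<close> and \<open>V\<close> have none, which makes their causality evident.\<close>

definition rhs_W :: "real \<Rightarrow> real fps \<Rightarrow> real fps \<Rightarrow> real fps" where
  "rhs_W \<beta> W V = - (W * (fps_const 3 * W + W * W) + V * (fps_const \<beta> * V + fps_const \<beta> * W * V))"

definition rhs_V :: "real \<Rightarrow> real \<Rightarrow> real fps \<Rightarrow> real fps \<Rightarrow> real fps" where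
  "rhs_V \<mu> \<gamma> W V = - (V * (fps_const \<mu> * V * V + fps_const \<gamma> * (fps_const 2 * W + W * W)))"

lemma causal_rhs_W: "causal (rhs_W \<beta>)"
  unfolding causal_def rhs_W_def
  by (intro allI impI agree_uminus agree_add agree_mult_Suc agree_mult agree_refl) auto

lemma causal_rhs_V: "causal (rhs_V \<mu> \<gamma>)"
  unfolding causal_def rhs_V_def
  by (intro allI impI agree_uminus agree_mult_Suc agree_add agree_mult agree_refl) auto

lemma causal_nth_zero:
  assumes "causal Q" "Q 0 0 = 0" "fps_nth F 0 = 0" "fps_nth G 0 = 0" "n < 2"
  shows "fps_nth (Q F G) n = 0"
proof -
  have "agree (Suc 1) (Q F G) (Q 0 0)"
    using assms(3,4) by (intro causalD[OF assms(1)]) (simp_all add: agree_def)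
  with assms(2,5) show ?thesis by (simp add: agree_def)
qed

lemma psum_rhs_W:
  assumes r: "0 \<le> r" and \<delta>: "0 \<le> \<delta>" "\<delta> \<le> 1" and F: "psum r N F \<le> \<delta>" and G: "psum r N G \<le> \<delta>"
  shows "psum r N (rhs_W \<beta> F G) \<le> (4 + 2 * \<bar>\<beta>\<bar>) * \<delta> * \<delta>"
proof -
  note le = psum_add_le[OF r] psum_mult_le[OF r] F G eq_refl[OF psum_const]
  have "psum r N (rhs_W \<beta> F G) \<le> \<delta> * (\<bar>3\<bar> * \<delta> + \<delta> * \<delta>) + \<delta> * (\<bar>\<beta>\<bar> * \<delta> + \<bar>\<beta>\<bar> * \<delta> * \<delta>)"
    unfolding rhs_W_def psum_uminus by (intro le)
  also have "\<dots> \<le> \<delta> * (\<bar>3\<bar> * \<delta> + 1 * \<delta>) + \<delta> * (\<bar>\<beta>\<bar> * \<delta> + \<bar>\<beta>\<bar> * \<delta> * 1)"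
    using \<delta> by (intro add_mono mult_left_mono mult_right_mono order_refl) simp_all
  also have "\<dots> = (4 + 2 * \<bar>\<beta>\<bar>) * \<delta> * \<delta>" by (simp add: algebra_simps)
  finally show ?thesis .
qed

lemma psum_rhs_V:
  assumes r: "0 \<le> r" and \<delta>: "0 \<le> \<delta>" "\<delta> \<le> 1" and F: "psum r N F \<le> \<delta>" and G: "psum r N G \<le> \<delta>"
  shows "psum r N (rhs_V \<mu> \<gamma> F G) \<le> (\<bar>\<mu>\<bar> + 3 * \<bar>\<gamma>\<bar>) * \<delta> * \<delta>"
proof -
  note le = psum_add_le[OF r] psum_mult_le[OF r] F G eq_refl[OF psum_const]
  have "psum r N (rhs_V \<mu> \<gamma> F G) \<le> \<delta> * (\<bar>\<mu>\<bar> * \<delta> * \<delta> + \<bar>\<gamma>\<bar> * (\<bar>2\<bar> * \<delta> + \<delta> * \<delta>))"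
    unfolding rhs_V_def psum_uminus by (intro le)
  also have "\<dots> \<le> \<delta> * (\<bar>\<mu>\<bar> * \<delta> * 1 + \<bar>\<gamma>\<bar> * (\<bar>2\<bar> * \<delta> + 1 * \<delta>))"
    using \<delta> by (intro add_mono mult_left_mono mult_right_mono order_refl) simp_all
  also have "\<dots> = (\<bar>\<mu>\<bar> + 3 * \<bar>\<gamma>\<bar>) * \<delta> * \<delta>" by (simp add: algebra_simps)
  finally show ?thesis .
qed

text \<open>Here \<open>k\<close> is \<open>\<kappa>^2\<close>; the linear factors \<open>d1 n\<close> and \<open>d2 n\<close> are the eigenvalues of the left-hand sides on
  \<open>X^n\<close>.\<close>

lemma fps_system_solution:
  fixes \<mu> \<beta> \<gamma> k :: real
  assumes k: "0 < k"
  obtains W V :: "real fps" and r :: real where "0 < r"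
    "ereal r \<le> fps_conv_radius W" "ereal r \<le> fps_conv_radius V"
    "fps_nth W 0 = 0" "fps_nth V 0 = 0" "fps_nth V 1 = 1"
    "fps_const k * fps_euler (fps_euler W) + fps_const 2 * W = rhs_W \<beta> W V"
    "fps_const k * fps_euler (fps_euler V) - fps_const k * V = rhs_V \<mu> \<gamma> W V"
proof -
  define d1 where "d1 n = k * real n ^ 2 + 2" for n
  define d2 where "d2 n = k * (real n ^ 2 - 1)" for n
  obtain W V where WV: "fps_nth W 0 = 0" "fps_nth W 1 = 0" "fps_nth V 0 = 0" "fps_nth V 1 = 1"
    and rec: "\<And>n. 2 \<le> n \<Longrightarrow> fps_nth W n = fps_nth (rhs_W \<beta> W V) n / d1 n"
      "\<And>n. 2 \<le> n \<Longrightarrow> fps_nth V n = fps_nth (rhs_V \<mu> \<gamma> W V) n / d2 n"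
    by (rule fps_pair_recursion[where ?d1.0 = d1 and ?d2.0 = d2, OF causal_rhs_W causal_rhs_V]) blast
  \<comment> \<open>\<open>K\<close> dominates the constants of the quadratic bounds, after division by a lower bound of
      the linear factors and, in the second equation, with a factor 2 to spare for \<open>r = \<delta> / 2\<close>.\<close>
  define K where "K = 4 + 2 * \<bar>\<beta>\<bar> + 2 * (\<bar>\<mu>\<bar> + 3 * \<bar>\<gamma>\<bar>) / k"
  define \<delta> where "\<delta> = 1 / K"
  define r where "r = \<delta> / 2"
  have pos: "0 \<le> 2 * (\<bar>\<mu>\<bar> + 3 * \<bar>\<gamma>\<bar>) / k" using k by simp
  have K: "4 \<le> K" "4 + 2 * \<bar>\<beta>\<bar> \<le> K" "2 * (\<bar>\<mu>\<bar> + 3 * \<bar>\<gamma>\<bar>) / k \<le> K"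
    using pos unfolding K_def by linarith+
  have \<delta>: "0 < \<delta>" "\<delta> \<le> 1" "K * \<delta> = 1" using K(1) by (simp_all add: \<delta>_def)
  have r: "0 < r" "r \<le> \<delta>" "0 \<le> r" using \<delta> by (simp_all add: r_def)
  have B1: "psum r N (rhs_W \<beta> F G) \<le> 1 * \<delta>" if "psum r N F \<le> \<delta>" "psum r N G \<le> \<delta>" for N F G
  proof -
    have "(4 + 2 * \<bar>\<beta>\<bar>) * \<delta> * \<delta> \<le> K * \<delta> * \<delta>"
      by (intro mult_right_mono K(2) less_imp_le[OF \<delta>(1)])
    with psum_rhs_W[OF r(3) less_imp_le[OF \<delta>(1)] \<delta>(2) that, of \<beta>] \<delta>(3) show ?thesis by simp
  qed
  have B2: "psum r N (rhs_V \<mu> \<gamma> F G) \<le> k * (\<delta> - r)" if "psum r N F \<le> \<delta>" "psum r N G \<le> \<delta>" for N F G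
  proof -
    have "\<bar>\<mu>\<bar> + 3 * \<bar>\<gamma>\<bar> \<le> k / 2 * K" using K(3) k by (simp add: field_simps)
    then have "(\<bar>\<mu>\<bar> + 3 * \<bar>\<gamma>\<bar>) * \<delta> * \<delta> \<le> k / 2 * K * \<delta> * \<delta>"
      by (intro mult_right_mono less_imp_le[OF \<delta>(1)])
    also have "\<dots> = k * (\<delta> - r)" using \<delta>(3) by (simp add: r_def mult.assoc)
    finally show ?thesis
      using psum_rhs_V[OF r(3) less_imp_le[OF \<delta>(1)] \<delta>(2) that, of \<mu> \<gamma>] by (rule order_trans[rotated])
  qed
  have sq: "4 \<le> real n ^ 2" if "2 \<le> n" for n
    using power_mono[of 2 "real n" 2] that by simp
  have m1: "1 \<le> d1 n" if "2 \<le> n" for n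
    using k by (simp add: d1_def add_increasing)
  have m2: "k \<le> d2 n" if "2 \<le> n" for n
    using sq[OF that] k unfolding d2_def by simp
  have bd: "psum r N W \<le> \<delta> \<and> psum r N V \<le> \<delta>" for N
    by (rule psum_recursion_bound[OF causal_rhs_W causal_rhs_V B1 B2 _ k m1 m2 r(3) r(2) WV rec])
      simp_all
  \<comment> \<open>The equations also hold at the indices 0 and 1, where the recursion was not used.\<close>
  have "rhs_W \<beta> 0 0 = 0" "rhs_V \<mu> \<gamma> 0 0 = 0"
    by (simp_all add: rhs_W_def rhs_V_def)
  then have zero: "fps_nth (rhs_W \<beta> W V) n = 0" "fps_nth (rhs_V \<mu> \<gamma> W V) n = 0" if "n < 2" for n
    using that WV(1,3) by (auto intro: causal_nth_zero causal_rhs_W causal_rhs_V)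
  have nth: "d1 n * fps_nth W n = fps_nth (rhs_W \<beta> W V) n"
    "d2 n * fps_nth V n = fps_nth (rhs_V \<mu> \<gamma> W V) n" for n
  proof -
    consider "2 \<le> n" | "n = 0" | "n = 1" by linarith
    then have "d1 n * fps_nth W n = fps_nth (rhs_W \<beta> W V) n \<and> d2 n * fps_nth V n = fps_nth (rhs_V \<mu> \<gamma> W V) n"
    proof cases
      case 1
      have "d1 n \<noteq> 0" "d2 n \<noteq> 0" using m1[OF 1] m2[OF 1] k by auto
      with rec[OF 1] show ?thesis by simp
    qed (use zero WV in \<open>simp_all add: d2_def\<close>)
    then show "d1 n * fps_nth W n = fps_nth (rhs_W \<beta> W V) n"
      "d2 n * fps_nth V n = fps_nth (rhs_V \<mu> \<gamma> W V) n" by blast+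
  qed
  have euler: "fps_nth (fps_euler (fps_euler F)) n = real n ^ 2 * fps_nth F n" for F n
    by (cases n) (simp_all add: power2_eq_square algebra_simps)
  have "fps_const k * fps_euler (fps_euler W) + fps_const 2 * W = rhs_W \<beta> W V"
    by (rule fps_ext, simp only: fps_add_nth fps_mult_left_const_nth euler nth[symmetric] d1_def)
      (simp add: algebra_simps)
  moreover have "fps_const k * fps_euler (fps_euler V) - fps_const k * V = rhs_V \<mu> \<gamma> W V"
    by (rule fps_ext, simp only: fps_sub_nth fps_mult_left_const_nth euler nth[symmetric] d2_def)
      (simp add: algebra_simps)
  moreover have "ereal r \<le> fps_conv_radius W" "ereal r \<le> fps_conv_radius V"
    using fps_conv_radius_ge_psum[OF r(3)] bd by blast+
  ultimately show thesis
    using that[OF r(1) _ _ WV(1,3,4)] by blast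
qed

section \<open>The solution of the Emden-Fowler system near the equilibrium\<close>

lemma fps_conv_radius_geI:
  fixes F G :: "real fps"
  assumes "R \<le> fps_conv_radius F" "R \<le> fps_conv_radius G"
  shows "R \<le> fps_conv_radius (F + G)" "R \<le> fps_conv_radius (F - G)" "R \<le> fps_conv_radius (F * G)"
  using order_trans[OF min.boundedI[OF assms]] fps_conv_radius_add fps_conv_radius_diff fps_conv_radius_mult
  by blast+

lemma fps_conv_radius_derivI: "R \<le> fps_conv_radius F \<Longrightarrow> R \<le> fps_conv_radius (fps_deriv F)"
  for F :: "real fps"
  using fps_conv_radius_deriv[of F] by (rule order_trans[rotated])

lemma emden_fowler_profile_exists:
  fixes \<mu>1 \<mu>2 \<beta> :: real
  assumes "0 < \<mu>1" and "\<beta> < \<mu>1"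
  shows "\<exists>s0 U U1 U2 V V1 V2. emden_fowler_profile \<mu>1 \<mu>2 \<beta> s0 U U1 U2 V V1 V2"
proof -
  define k where "k = 1 - \<beta> / \<mu>1"
  define \<gamma> where "\<gamma> = \<beta> / \<mu>1"
  have k: "0 < k" "k = 1 - \<gamma>" using assms by (simp_all add: k_def \<gamma>_def)
  obtain W V :: "real fps" and r :: real where r: "0 < r"
    and cr: "ereal r \<le> fps_conv_radius W" "ereal r \<le> fps_conv_radius V"
    and nth: "fps_nth W 0 = 0" "fps_nth V 0 = 0" "fps_nth V 1 = 1"
    and eqW: "fps_const k * fps_euler (fps_euler W) + fps_const 2 * W = rhs_W \<beta> W V"
    and eqV: "fps_const k * fps_euler (fps_euler V) - fps_const k * V = rhs_V \<mu>2 \<gamma> W V"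
    by (rule fps_system_solution[OF k(1)])
  have lt: "ereal (norm s) < fps_conv_radius F" if "\<bar>s\<bar> < r" "ereal r \<le> fps_conv_radius F" for s F
    using that by (metis ereal_less_eq(3) less_ereal.simps(1) order_less_le_trans real_norm_def)
  have ev: "eval_fps (F + G) s = eval_fps F s + eval_fps G s"
     "eval_fps (F - G) s = eval_fps F s - eval_fps G s"
     "eval_fps (F * G) s = eval_fps F s * eval_fps G s"
    if "\<bar>s\<bar> < r" "ereal r \<le> fps_conv_radius F" "ereal r \<le> fps_conv_radius G" for s F G
    using that by (auto intro!: eval_fps_add eval_fps_diff eval_fps_mult lt)
  have evm: "eval_fps (- F) s = - eval_fps F s" if "\<bar>s\<bar> < r" "ereal r \<le> fps_conv_radius F" for s F
    using that by (auto intro!: eval_fps_minus lt)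
  note cr_intros = fps_conv_radius_geI fps_conv_radius_derivI cr
  have crE: "ereal r \<le> fps_conv_radius (fps_euler F)" if "ereal r \<le> fps_conv_radius F" for F
    using that by (intro cr_intros) auto
  have der: "(eval_fps F has_real_derivative eval_fps (fps_euler F) s / s) (at s)"
    if "0 < s" "s < r" "ereal r \<le> fps_conv_radius F" for F s
    using has_field_derivative_eval_fps[OF lt[of s F], of UNIV] that
    by (simp add: ev cr_intros)
  have cont: "isCont (eval_fps F) s" if "\<bar>s\<bar> < r" "ereal r \<le> fps_conv_radius F" for F s
    using continuous_eval_fps[OF lt[OF that]] by simp
  have lim: "(eval_fps F \<longlongrightarrow> fps_nth F 0) (at_right 0)" if "ereal r \<le> fps_conv_radius F" for F :: "real fps"
    using cont[of 0 F] that r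
    by (auto simp: isCont_def eval_fps_at_0 intro: tendsto_mono[of "at_right 0" "at 0", OF at_le])
  have odeW: "k * eval_fps (fps_euler (fps_euler W)) s + 2 * eval_fps W s =
     - (eval_fps W s * (3 * eval_fps W s + eval_fps W s * eval_fps W s) +
        eval_fps V s * (\<beta> * eval_fps V s + \<beta> * eval_fps W s * eval_fps V s))" if "\<bar>s\<bar> < r" for s
  proof -
    note [simp] = ev[OF that] evm[OF that] cr_intros
    show ?thesis using arg_cong[OF eqW[unfolded rhs_W_def], of "\<lambda>F. eval_fps F s"] by simp
  qed
  have odeV: "k * eval_fps (fps_euler (fps_euler V)) s - k * eval_fps V s =
     - (eval_fps V s * (\<mu>2 * eval_fps V s * eval_fps V s +
        \<gamma> * (2 * eval_fps W s + eval_fps W s * eval_fps W s)))" if "\<bar>s\<bar> < r" for s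
  proof -
    note [simp] = ev[OF that] evm[OF that] cr_intros
    show ?thesis using arg_cong[OF eqV[unfolded rhs_V_def], of "\<lambda>F. eval_fps F s"] by simp
  qed
  \<comment> \<open>Positivity of \<open>V\<close> for small \<open>s > 0\<close> comes from \<open>V_0 = 0\<close> and \<open>V_1 = 1\<close>.\<close>
  have "(eval_fps V has_real_derivative 1) (at 0)"
    using has_field_derivative_eval_fps[OF lt[of 0 V], of UNIV] r cr nth by (simp add: eval_fps_at_0)
  from DERIV_pos_inc_right[OF this] obtain d1 where d1: "0 < d1"
    "\<And>s. 0 < s \<Longrightarrow> s < d1 \<Longrightarrow> 0 < eval_fps V s"
    using nth by (auto simp: eval_fps_at_0)
  have "eventually (\<lambda>s. eval_fps W s > - 1) (at_right 0)"
    using lim[OF cr(1)] nth by (intro order_tendstoD(1)) auto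
  then obtain d2 where d2: "0 < d2" "\<And>s. 0 < s \<Longrightarrow> s < d2 \<Longrightarrow> - 1 < eval_fps W s"
    unfolding eventually_at_right_field by auto
  define s0 where "s0 = min r (min d1 d2)"
  have sq: "sqrt \<mu>1 > 0" "sqrt \<mu>1 ^ 2 = \<mu>1" using assms by auto
  have "emden_fowler_profile \<mu>1 \<mu>2 \<beta> s0 (\<lambda>s. (1 + eval_fps W s) / sqrt \<mu>1)
    (\<lambda>s. eval_fps (fps_euler W) s / sqrt \<mu>1) (\<lambda>s. eval_fps (fps_euler (fps_euler W)) s / sqrt \<mu>1)
    (eval_fps V) (eval_fps (fps_euler V)) (eval_fps (fps_euler (fps_euler V)))"
  proof
    show "0 < \<mu>1" "\<beta> < \<mu>1" by (fact assms)+
    show "0 < s0" using r d1 d2 by (simp add: s0_def)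
    fix s assume s: "0 < s" "s < s0"
    then have s': "0 < s" "s < r" "\<bar>s\<bar> < r" by (auto simp: s0_def)
    show "((\<lambda>s. (1 + eval_fps W s) / sqrt \<mu>1) has_real_derivative eval_fps (fps_euler W) s / sqrt \<mu>1 / s) (at s)"
      using DERIV_cdivide[OF DERIV_add[OF DERIV_const der[OF s'(1,2) cr(1)]], of 1 "sqrt \<mu>1"]
      by (simp add: divide_divide_eq_left mult.commute)
    show "((\<lambda>s. eval_fps (fps_euler W) s / sqrt \<mu>1) has_real_derivative
        eval_fps (fps_euler (fps_euler W)) s / sqrt \<mu>1 / s) (at s)"
      using DERIV_cdivide[OF der[OF s'(1,2) crE[OF cr(1)]], of "sqrt \<mu>1"]
      by (simp add: divide_divide_eq_left mult.commute)
    show "(eval_fps V has_real_derivative eval_fps (fps_euler V) s / s) (at s)"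
      "(eval_fps (fps_euler V) has_real_derivative eval_fps (fps_euler (fps_euler V)) s / s) (at s)"
      by (intro der s' cr crE)+
    show "0 < (1 + eval_fps W s) / sqrt \<mu>1" "0 < eval_fps V s"
      using s d1 d2(2)[of s] sq by (auto simp: s0_def)
    have cube: "\<mu>1 * (a / sqrt \<mu>1) ^ 3 = a ^ 3 / sqrt \<mu>1" for a
      using sq by (simp add: power_divide power3_eq_cube power2_eq_square field_simps)
    have "k * eval_fps (fps_euler (fps_euler W)) s =
      (1 + eval_fps W s) - (1 + eval_fps W s) ^ 3 - \<beta> * (1 + eval_fps W s) * (eval_fps V s)\<^sup>2"
      using odeW[OF s'(3)] by algebra
    then show "(1 - \<beta> / \<mu>1) * (eval_fps (fps_euler (fps_euler W)) s / sqrt \<mu>1) =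
      (1 + eval_fps W s) / sqrt \<mu>1 - \<mu>1 * ((1 + eval_fps W s) / sqrt \<mu>1) ^ 3 -
       \<beta> * ((1 + eval_fps W s) / sqrt \<mu>1) * (eval_fps V s)\<^sup>2"
      unfolding k_def[symmetric] cube times_divide_eq_right times_divide_eq_left
      by (simp only: diff_divide_distrib)
    have "k * eval_fps (fps_euler (fps_euler V)) s =
      eval_fps V s - \<mu>2 * eval_fps V s ^ 3 - \<gamma> * eval_fps V s * (1 + eval_fps W s)\<^sup>2"
      using odeV[OF s'(3)] k(2) by algebra
    then show "(1 - \<beta> / \<mu>1) * eval_fps (fps_euler (fps_euler V)) s =
      eval_fps V s - \<mu>2 * eval_fps V s ^ 3 - \<beta> * eval_fps V s * ((1 + eval_fps W s) / sqrt \<mu>1)\<^sup>2"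
      using assms unfolding k_def[symmetric] by (simp add: \<gamma>_def power_divide)
  next
    have c: "continuous_on {0<..<s0} (eval_fps F)" if "ereal r \<le> fps_conv_radius F" for F
      using that by (auto intro!: continuous_at_imp_continuous_on cont simp: s0_def)
    show "continuous_on {0<..<s0} (\<lambda>s. eval_fps (fps_euler (fps_euler W)) s / sqrt \<mu>1)"
      using sq by (intro continuous_intros c crE cr) auto
    show "continuous_on {0<..<s0} (eval_fps (fps_euler (fps_euler V)))"
      by (intro c crE cr)
    show "((\<lambda>s. (1 + eval_fps W s) / sqrt \<mu>1) \<longlongrightarrow> 1 / sqrt \<mu>1) (at_right 0)"
      using lim[OF cr(1)] nth sq by (auto intro!: tendsto_eq_intros)
    show "((\<lambda>s. eval_fps (fps_euler W) s / sqrt \<mu>1) \<longlongrightarrow> 0) (at_right 0)"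
      using lim[OF crE[OF cr(1)]] sq by (auto intro!: tendsto_eq_intros)
    show "(eval_fps V \<longlongrightarrow> 0) (at_right 0)" "(eval_fps (fps_euler V) \<longlongrightarrow> 0) (at_right 0)"
      using lim[OF cr(2)] lim[OF crE[OF cr(2)]] nth by simp_all
  qed
  then show ?thesis by blast
qed

theorem theorem1p5:
  fixes \<mu>1 \<mu>2 \<beta> :: real
  assumes "0 < \<mu>1" and "0 < \<mu>2" and "0 < \<beta>" and "\<beta> < \<mu>1"
  shows "\<exists>(u :: real^4 \<Rightarrow> real) v.
    is_positive_solution \<mu>1 \<mu>2 \<beta> u v \<and>
    radially_symmetric_on (ball 0 2 - {0}) u \<and> radially_symmetric_on (ball 0 2 - {0}) v \<and>
    (\<exists>D<0. \<forall>r. 0 < r \<and> r < 2 \<longrightarrow> pohozaev \<mu>1 \<mu>2 \<beta> r u v = D) \<and>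
    ((\<lambda>x. norm x * u x) \<longlongrightarrow> 1 / sqrt \<mu>1) (at 0) \<and>
    ((\<lambda>x. norm x * v x) \<longlongrightarrow> 0) (at 0) \<and>
    \<not> (\<exists>C1>0. eventually (\<lambda>x. v x \<ge> C1 * inverse (norm x)) (at 0))"
proof -
  from emden_fowler_profile_exists[OF assms(1,4), of \<mu>2]
  obtain s0 U U1 U2 V V1 V2 where "emden_fowler_profile \<mu>1 \<mu>2 \<beta> s0 U U1 U2 V V1 V2" by blast
  then show ?thesis by (rule emden_fowler_profile.singular_solution)
qed

end
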